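(* Let $A\in M_{d\times d}$ have $d$ distinct eigenvalues (over $\mathbb{C}$), let $\mathbf{x}_0\in\mathbb{R}^d$, and let $w_0^*$ be the Initial Condition-based Identifiability Score (ICIS) of $(A,\mathbf{x}_0)$, computed from a real Jordan decomposition $A=Q\Lambda Q^{-1}$. Then the ODE system $D\mathbf{x}(t)=A\mathbf{x}(t)$ is identifiable at $\mathbf{x}_0$ if and only if $w_0^*\neq 0$.
   Context: $M_{d\times d}$ is the set of real $d\times d$ matrices, $D=\frac{d}{dt}$, and $T>0$ is fixed. For $A\in M_{d\times d}$ and $\mathbf{x}_0\in\mathbb{R}^d$, $\mathbf{x}(t|A,\mathbf{x}_0)=e^{tA}\mathbf{x}_0$ is the solution of $D\mathbf{x}(t)=A\mathbf{x}(t)$, $\mathbf{x}(0)=\mathbf{x}_0$. Identifiability: $A$ is identifiable at $\mathbf{x}_0$ if for all $B\in M_{d\times d}$ with $B\ne A$, $\mathbf{x}(t|A,\mathbf{x}_0)\neq\mathbf{x}(t|B,\mathbf{x}_0)$ for some $0<t<T$. Real Jordan decomposition: since $A$ has $d$ distinct eigenvalues, $A=Q\Lambda Q^{-1}$ with $Q$ real invertible and $\Lambda=\mathrm{diag}(J_1,\dots,J_K)$ block diagonal, $K=K_1+K_2$, $d=K_1+2K_2$, where $J_k=(c_k)$ is $1\times1$ for $k=1,\dots,K_1$ (the real eigenvalues) and $J_k=\begin{pmatrix}a_k&-b_k\\ b_k&a_k\end{pmatrix}$, $b_k\neq0$, for $k=K_1+1,\dots,K$ (the pairs of complex eigenvalues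 $a_k\pm b_k i$). For $k>K_1$ put $i(k)=2k-K_1-1$. ICIS: let $\tilde{\mathbf{x}}_0=Q^{-1}\mathbf{x}_0$. Put $w_{0,k}=\tilde{\mathbf{x}}_{0,k}\in\mathbb{R}$ for $k\le K_1$ and $w_{0,k}=(\tilde{\mathbf{x}}_{0,i(k)},\tilde{\mathbf{x}}_{0,i(k)+1})'\in\mathbb{R}^2$ for $K_1<k\le K$. Then $w_0^*=\min_{1\le k\le K}|w_{0,k}|$, with $|\cdot|$ the absolute value or Euclidean norm. *)

theory Defs
  imports Complex_Main "Jordan_Normal_Form.Char_Poly"
begin

section \<open>Matrix exponential and solutions of linear ODE systems\<close>

text \<open>The matrix type carries no topology, so the exponential series
  \<open>\<Sum>n. A ^ n / n!\<close> is taken entry by entry. Each of these real series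
  converges when \<open>A\<close> is square, see \<open>summable_mat_exp\<close> below.\<close>

definition mat_exp :: "real mat \<Rightarrow> real mat" where
  "mat_exp A = mat (dim_row A) (dim_col A) (\<lambda>(i, j). \<Sum>n. (A ^\<^sub>m n) $$ (i, j) / fact n)"

lemma summable_mat_exp:
  assumes A: "A \<in> carrier_mat d d" and i: "i < d" and j: "j < d"
  shows "summable (\<lambda>n. (A ^\<^sub>m n) $$ (i, j) / fact n :: real)"
proof -
  define M where "M = (\<Sum>p\<in>{..<d} \<times> {..<d}. \<bar>A $$ p\<bar>)"
  have M: "\<bar>A $$ (k, l)\<bar> \<le> M" if "k < d" "l < d" for k l
    unfolding M_def using that by (intro member_le_sum[of "(k, l)" _ "\<lambda>p. \<bar>A $$ p\<bar>"]) auto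
  have bound: "\<bar>(A ^\<^sub>m n) $$ (i, l)\<bar> \<le> (real d * M) ^ n" if "l < d" for n l
    using that
  proof (induction n arbitrary: l)
    case 0
    then show ?case using A i by auto
  next
    case (Suc n)
    have An: "A ^\<^sub>m n \<in> carrier_mat d d" using A by simp
    have "(A ^\<^sub>m Suc n) $$ (i, l) = (\<Sum>k = 0..<d. (A ^\<^sub>m n) $$ (i, k) * A $$ (k, l))"
      using A An i Suc.prems by (auto simp: scalar_prod_def intro!: sum.cong)
    also have "\<bar>\<dots>\<bar> \<le> (\<Sum>k = 0..<d. \<bar>(A ^\<^sub>m n) $$ (i, k)\<bar> * \<bar>A $$ (k, l)\<bar>)"
      by (metis (no_types, lifting) abs_mult sum.cong sum_abs)
    also have "\<dots> \<le> (\<Sum>k = 0..<d. (real d * M) ^ n * M)"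
    proof (intro sum_mono mult_mono)
      fix k assume "k \<in> {0..<d}"
      then have k: "k < d" by simp
      show "\<bar>(A ^\<^sub>m n) $$ (i, k)\<bar> \<le> (real d * M) ^ n" by (rule Suc.IH[OF k])
      then show "0 \<le> (real d * M) ^ n" by linarith
      show "\<bar>A $$ (k, l)\<bar> \<le> M" by (rule M[OF k Suc.prems])
    qed simp
    also have "\<dots> = (real d * M) ^ Suc n" by simp
    finally show ?case .
  qed
  have "summable (\<lambda>n. (real d * M) ^ n / fact n)"
    using summable_exp[of "real d * M"] by (simp add: divide_inverse mult.commute)
  then show ?thesis
    by (rule summable_comparison_test'[where N = 0]) (use bound[OF j] in \<open>simp add: divide_right_mono\<close>)
qed

definition ode_solution :: "real mat \<Rightarrow> real vec \<Rightarrow> real \<Rightarrow> real vec" where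
  "ode_solution A x0 t = mat_exp (t \<cdot>\<^sub>m A) *\<^sub>v x0"

definition identifiable_at :: "nat \<Rightarrow> real \<Rightarrow> real mat \<Rightarrow> real vec \<Rightarrow> bool" where
  "identifiable_at d T A x0 \<longleftrightarrow>
     (\<forall>B \<in> carrier_mat d d. B \<noteq> A \<longrightarrow>
        (\<exists>t. 0 < t \<and> t < T \<and> ode_solution A x0 t \<noteq> ode_solution B x0 t))"

section \<open>Real Jordan decomposition\<close>

text \<open>Blocks are numbered \<open>1, \<dots>, K1 + K2\<close>: the first \<open>K1\<close> belong to the real
  eigenvalues \<open>c k\<close>, the others to the conjugate pairs \<open>a k \<plusminus> b k \<i>\<close>. Only
  \<open>c k\<close> with \<open>k \<le> K1\<close> and \<open>a k\<close>, \<open>b k\<close> with \<open>k > K1\<close> matter.\<close>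

definition real_jordan_block ::
  "nat \<Rightarrow> (nat \<Rightarrow> real) \<Rightarrow> (nat \<Rightarrow> real) \<Rightarrow> (nat \<Rightarrow> real) \<Rightarrow> nat \<Rightarrow> real mat" where
  "real_jordan_block K1 c a b k =
     (if k \<le> K1 then mat_of_rows_list 1 [[c k]]
      else mat_of_rows_list 2 [[a k, - b k], [b k, a k]])"

definition real_jordan_matrix ::
  "nat \<Rightarrow> nat \<Rightarrow> (nat \<Rightarrow> real) \<Rightarrow> (nat \<Rightarrow> real) \<Rightarrow> (nat \<Rightarrow> real) \<Rightarrow> real mat" where
  "real_jordan_matrix K1 K2 c a b =
     diag_block_mat (map (real_jordan_block K1 c a b) [1..<K1 + K2 + 1])"

text \<open>The witness form of similarity says that \<open>A = Q * \<Lambda> * Q'\<close> where \<open>Q'\<close> is the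
  two-sided inverse of \<open>Q\<close>.\<close>

definition real_jordan_decomposition ::
  "real mat \<Rightarrow> real mat \<Rightarrow> real mat \<Rightarrow> nat \<Rightarrow> nat \<Rightarrow>
   (nat \<Rightarrow> real) \<Rightarrow> (nat \<Rightarrow> real) \<Rightarrow> (nat \<Rightarrow> real) \<Rightarrow> bool" where
  "real_jordan_decomposition A Q Q' K1 K2 c a b \<longleftrightarrow>
     dim_row A = K1 + 2 * K2 \<and>
     (\<forall>k. K1 < k \<and> k \<le> K1 + K2 \<longrightarrow> b k \<noteq> 0) \<and>
     similar_mat_wit A (real_jordan_matrix K1 K2 c a b) Q Q'"

section \<open>Initial condition-based identifiability score\<close>

text \<open>\<open>jordan_pos K1 k\<close> is the coordinate, counted from 1, at which the two-dimensional
  block \<open>k > K1\<close> starts. Entries of a vector are counted from 0, so the coordinates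
  \<open>1, 2, \<dots>\<close> of a vector \<open>y\<close> are \<open>y $ 0, y $ 1, \<dots>\<close>.\<close>

definition jordan_pos :: "nat \<Rightarrow> nat \<Rightarrow> nat" where
  "jordan_pos K1 k = 2 * k - K1 - 1"

definition block_norm :: "nat \<Rightarrow> real vec \<Rightarrow> nat \<Rightarrow> real" where
  "block_norm K1 y k =
     (if k \<le> K1 then \<bar>y $ (k - 1)\<bar>
      else sqrt ((y $ (jordan_pos K1 k - 1))\<^sup>2 + (y $ (jordan_pos K1 k + 1 - 1))\<^sup>2))"

definition icis :: "nat \<Rightarrow> nat \<Rightarrow> real mat \<Rightarrow> real vec \<Rightarrow> real" where
  "icis K1 K2 Q' x0 = Min (block_norm K1 (Q' *\<^sub>v x0) ` {1..K1 + K2})"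

end

theory Submission
  imports Defs
begin

text \<open>
Write \<open>A = Q * L * Q'\<close> with \<open>L\<close> the real Jordan matrix and \<open>y = Q' *\<^sub>v x0\<close>.

A solution is an everywhere convergent power series in \<open>t\<close> whose coefficients are the
iterates \<open>A ^\<^sub>m n *\<^sub>v x0\<close> divided by \<open>n!\<close>, so observing it on any interval
\<open>(0, T)\<close> is the same as knowing the orbit \<open>x0, A x0, A\<^sup>2 x0, \<dots>\<close>
(\<open>ode_solutions_agree_iff\<close>). A matrix with the same orbit as \<open>A\<close> agrees with \<open>A\<close> on its
span, and off the span it can be changed at will. Hence \<open>A\<close> is identifiable at \<open>x0\<close> exactly
if the orbit spans the whole space, that is, if \<open>x0\<close> is a cyclic vector of \<open>A\<close>
(\<open>identifiable_at_iff_cyclic_vector\<close>). Cyclicity is invariant under a change of basis, so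
\<open>L\<close> and \<open>y\<close> may replace \<open>A\<close> and \<open>x0\<close>.

Reading each two-dimensional block as a complex line turns the real space into a product of
\<open>K1\<close> real and \<open>K2\<close> complex lines. On line \<open>k\<close> the matrix \<open>L\<close> multiplies by a number
\<open>\<lambda>\<^sub>k\<close>, and the norm of the block component \<open>w\<^sub>k\<close> of \<open>y\<close> is the modulus of its
complex coordinate. If \<open>w\<^sub>k = 0\<close>, the orbit of \<open>y\<close> stays in a proper coordinate subspace
and cannot span. Conversely, a vector \<open>u\<close> orthogonal to the orbit satisfies
\<open>\<Sum>k. Re (cnj u\<^sub>k * w\<^sub>k * \<lambda>\<^sub>k ^ n) = 0\<close> for all \<open>n\<close>. Since there are \<open>d\<close> distinct
eigenvalues, no \<open>\<lambda>\<^sub>k\<close> equals another \<open>\<lambda>\<^sub>j\<close> or its conjugate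
(\<open>block_eigenvalues_separated\<close>), and then all coefficients \<open>cnj u\<^sub>k * w\<^sub>k\<close> vanish
(\<open>damped_oscillations_independent\<close>). If no \<open>w\<^sub>k\<close> is zero, this leaves only \<open>u = 0\<close>.
\<close>

section \<open>Solutions and iterates of the initial vector\<close>

text \<open>The one-sided interval suffices because the sum is continuous at \<open>0\<close>: once the lower
  coefficients are known to vanish, dividing by \<open>t ^ n\<close> leaves a power series that is zero for
  small positive \<open>t\<close> and tends to its constant term \<open>a n\<close>.\<close>

lemma powser_coeffs_eq_0:
  fixes a :: "nat \<Rightarrow> real"
  assumes "0 < T" and zero: "\<And>t. 0 < t \<Longrightarrow> t < T \<Longrightarrow> (\<lambda>n. a n * t ^ n) sums 0"
  shows "a n = 0"
proof (induction n rule: less_induct)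
  case (less n)
  have shifted: "(\<lambda>m. a (m + n) * t ^ m) sums 0" if t: "0 < t" "t < T" for t
  proof -
    have "(\<lambda>m. a (m + n) * t ^ (m + n)) sums (0 - (\<Sum>i<n. a i * t ^ i))"
      using sums_split_initial_segment[OF zero[OF t]] .
    then have "(\<lambda>m. a (m + n) * t ^ (m + n)) sums 0"
      using less by simp
    then have "(\<lambda>m. a (m + n) * t ^ (m + n) / t ^ n) sums (0 / t ^ n)"
      by (rule sums_divide)
    then show ?thesis using t by (simp add: power_add)
  qed
  define g where "g t = (\<Sum>m. a (m + n) * t ^ m)" for t
  have half: "summable (\<lambda>m. a (m + n) * (T / 2) ^ m)"
    using \<open>0 < T\<close> by (intro sums_summable[OF shifted]) auto
  have "(\<lambda>m. a (m + n) * t ^ m) sums g t" if "norm t < T / 2" for t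
    unfolding g_def
  proof (rule summable_sums, rule powser_inside[OF half])
    show "norm t < norm (T / 2)" using that by simp
  qed
  then have "(g \<longlongrightarrow> a (0 + n)) (at 0)"
    using \<open>0 < T\<close> by (intro powser_limit_0[of "T / 2"]) simp_all
  then have lim: "(g \<longlongrightarrow> a n) (at_right 0)"
    by (simp add: filterlim_at_split)
  have "eventually (\<lambda>t. g t = 0) (at_right 0)"
    unfolding eventually_at_right_field
    using \<open>0 < T\<close> shifted by (intro exI[of _ T]) (auto simp: g_def dest: sums_unique[symmetric])
  then have "(g \<longlongrightarrow> 0) (at_right 0)"
    by (rule tendsto_eventually)
  with lim show ?case
    using tendsto_unique trivial_limit_at_right_real by blast
qed

lemma smult_mat_pow:
  fixes A :: "'a :: comm_semiring_1 mat"
  assumes A: "A \<in> carrier_mat d d"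
  shows "(t \<cdot>\<^sub>m A) ^\<^sub>m n = t ^ n \<cdot>\<^sub>m A ^\<^sub>m n"
proof (induction n)
  case 0
  then show ?case using A by (intro eq_matI) auto
next
  case (Suc n)
  have An: "A ^\<^sub>m n \<in> carrier_mat d d" using A by simp
  show ?case
    using A An by (intro eq_matI) (auto simp: Suc ac_simps)
qed

text \<open>The finite sum over the columns may be exchanged with the exponential series, which gives
  the Taylor coefficients of the solution in terms of the orbit of the initial vector.\<close>

lemma ode_solution_sums:
  assumes A: "A \<in> carrier_mat d d" and x0: "x0 \<in> carrier_vec d" and i: "i < d"
  shows "(\<lambda>n. (A ^\<^sub>m n *\<^sub>v x0) $ i / fact n * t ^ n) sums (ode_solution A x0 t $ i)"
proof -
  have tA: "t \<cdot>\<^sub>m A \<in> carrier_mat d d" using A by simp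
  have "(\<lambda>n. \<Sum>j = 0..<d. ((t \<cdot>\<^sub>m A) ^\<^sub>m n) $$ (i, j) / fact n * x0 $ j) sums
        (\<Sum>j = 0..<d. (\<Sum>n. ((t \<cdot>\<^sub>m A) ^\<^sub>m n) $$ (i, j) / fact n) * x0 $ j)"
    using i by (intro sums_sum sums_mult2 summable_sums summable_mat_exp[OF tA]) auto
  also have "(\<Sum>j = 0..<d. (\<Sum>n. ((t \<cdot>\<^sub>m A) ^\<^sub>m n) $$ (i, j) / fact n) * x0 $ j)
      = ode_solution A x0 t $ i"
    using A x0 i by (simp add: ode_solution_def mat_exp_def scalar_prod_def)
  also have "(\<lambda>n. \<Sum>j = 0..<d. ((t \<cdot>\<^sub>m A) ^\<^sub>m n) $$ (i, j) / fact n * x0 $ j)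
      = (\<lambda>n. (A ^\<^sub>m n *\<^sub>v x0) $ i / fact n * t ^ n)"
  proof
    fix n
    have An: "A ^\<^sub>m n \<in> carrier_mat d d" using A by simp
    show "(\<Sum>j = 0..<d. ((t \<cdot>\<^sub>m A) ^\<^sub>m n) $$ (i, j) / fact n * x0 $ j)
        = (A ^\<^sub>m n *\<^sub>v x0) $ i / fact n * t ^ n"
      using An A x0 i
      by (simp add: smult_mat_pow[OF A] scalar_prod_def sum_distrib_left sum_divide_distrib ac_simps)
  qed
  finally show ?thesis .
qed

lemma dim_ode_solution [simp]: "dim_vec (ode_solution A x0 t) = dim_row A"
  by (simp add: ode_solution_def mat_exp_def)

lemma ode_solutions_agree_iff:
  assumes "0 < T" and A: "A \<in> carrier_mat d d" and B: "B \<in> carrier_mat d d"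
    and x0: "x0 \<in> carrier_vec d"
  shows "(\<forall>t. 0 < t \<and> t < T \<longrightarrow> ode_solution A x0 t = ode_solution B x0 t) \<longleftrightarrow>
         (\<forall>n. A ^\<^sub>m n *\<^sub>v x0 = B ^\<^sub>m n *\<^sub>v x0)"
proof safe
  fix n
  assume agree: "\<forall>t. 0 < t \<and> t < T \<longrightarrow> ode_solution A x0 t = ode_solution B x0 t"
  show "A ^\<^sub>m n *\<^sub>v x0 = B ^\<^sub>m n *\<^sub>v x0"
  proof (rule eq_vecI)
    fix i assume "i < dim_vec (B ^\<^sub>m n *\<^sub>v x0)"
    then have i: "i < d" using B by simp
    have "(A ^\<^sub>m n *\<^sub>v x0) $ i / fact n - (B ^\<^sub>m n *\<^sub>v x0) $ i / fact n = 0"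
    proof (rule powser_coeffs_eq_0[OF \<open>0 < T\<close>])
      fix t :: real assume "0 < t" "t < T"
      then show "(\<lambda>n. ((A ^\<^sub>m n *\<^sub>v x0) $ i / fact n - (B ^\<^sub>m n *\<^sub>v x0) $ i / fact n) * t ^ n) sums 0"
        using sums_diff[OF ode_solution_sums[OF A x0 i] ode_solution_sums[OF B x0 i], of t t] agree
        by (simp add: left_diff_distrib)
    qed
    then show "(A ^\<^sub>m n *\<^sub>v x0) $ i = (B ^\<^sub>m n *\<^sub>v x0) $ i" by simp
  qed (use A B in simp)
next
  fix t
  assume eq: "\<forall>n. A ^\<^sub>m n *\<^sub>v x0 = B ^\<^sub>m n *\<^sub>v x0"
  show "ode_solution A x0 t = ode_solution B x0 t"
  proof (rule eq_vecI)
    fix i assume "i < dim_vec (ode_solution B x0 t)"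
    then have i: "i < d" using B by simp
    have "(\<lambda>n. (A ^\<^sub>m n *\<^sub>v x0) $ i / fact n * t ^ n) sums (ode_solution B x0 t $ i)"
      using ode_solution_sums[OF B x0 i, of t] by (simp only: eq)
    then show "ode_solution A x0 t $ i = ode_solution B x0 t $ i"
      using sums_unique2[OF ode_solution_sums[OF A x0 i]] by blast
  qed (use A B in simp)
qed

section \<open>Identifiability as a spanning property\<close>

lemma pow_mat_Suc_mult_vec:
  assumes A: "A \<in> carrier_mat d d" and x: "x \<in> carrier_vec d"
  shows "A ^\<^sub>m Suc n *\<^sub>v x = A *\<^sub>v (A ^\<^sub>m n *\<^sub>v x)"
proof -
  have An: "A ^\<^sub>m n \<in> carrier_mat d d" using A by simp
  have "A ^\<^sub>m Suc n = A * A ^\<^sub>m n"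
  proof (induction n)
    case 0
    then show ?case using A by simp
  next
    case (Suc n)
    have An: "A ^\<^sub>m n \<in> carrier_mat d d" using A by simp
    have "A ^\<^sub>m Suc (Suc n) = A * A ^\<^sub>m n * A" using Suc by (metis pow_mat.simps(2))
    also have "\<dots> = A * (A ^\<^sub>m n * A)" by (rule assoc_mult_mat[OF A An A])
    finally show ?case by (simp only: pow_mat.simps)
  qed
  then show ?thesis using assoc_mult_mat_vec[OF A An x] by (simp only:)
qed

text \<open>A vector is cyclic if its orbit spans the space. Spanning is expressed dually, by the
  vanishing of every vector orthogonal to the orbit, because the orthogonal vectors that occur
  below are the rows of a difference of two matrices.\<close>

definition cyclic_vector :: "nat \<Rightarrow> real mat \<Rightarrow> real vec \<Rightarrow> bool" where
  "cyclic_vector d A x \<longleftrightarrow>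
     (\<forall>v \<in> carrier_vec d. (\<forall>n. v \<bullet> (A ^\<^sub>m n *\<^sub>v x) = 0) \<longrightarrow> v = 0\<^sub>v d)"

text \<open>If a nonzero \<open>v\<close> is orthogonal to the orbit, adding the matrix \<open>C\<close> all of whose rows are
  \<open>v\<close> changes \<open>A\<close> but not the orbit. If \<open>B\<close> has the same orbit as \<open>A\<close>, both map each
  orbit vector to the next one, so every row of \<open>B - A\<close> is orthogonal to the orbit.\<close>

lemma identifiable_at_iff_cyclic_vector:
  assumes "0 < d" and "0 < T" and A: "A \<in> carrier_mat d d" and x0: "x0 \<in> carrier_vec d"
  shows "identifiable_at d T A x0 \<longleftrightarrow> cyclic_vector d A x0"
    (is "?I \<longleftrightarrow> ?S")
proof -
  have An: "A ^\<^sub>m n \<in> carrier_mat d d" for n using A by simp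
  have orbit: "A ^\<^sub>m n *\<^sub>v x0 \<in> carrier_vec d" for n using An x0 by (rule mult_mat_vec_carrier)
  have ident: "?I \<longleftrightarrow> (\<forall>B \<in> carrier_mat d d. (\<forall>n. A ^\<^sub>m n *\<^sub>v x0 = B ^\<^sub>m n *\<^sub>v x0) \<longrightarrow> B = A)"
    unfolding identifiable_at_def using ode_solutions_agree_iff[OF \<open>0 < T\<close> A _ x0] by blast
  show ?thesis
  proof
    assume ?I
    show ?S
      unfolding cyclic_vector_def
    proof (intro ballI impI)
      fix v assume v: "v \<in> carrier_vec d" and ann: "\<forall>n. v \<bullet> (A ^\<^sub>m n *\<^sub>v x0) = 0"
      define C where "C = mat d d (\<lambda>(i, j). v $ j)"
      have C: "C \<in> carrier_mat d d" by (simp add: C_def)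
      have C_orbit: "C *\<^sub>v (A ^\<^sub>m n *\<^sub>v x0) = 0\<^sub>v d" for n
      proof (rule eq_vecI)
        fix i assume "i < dim_vec (0\<^sub>v d :: real vec)"
        then have i: "i < d" by simp
        have "row C i = v" using i v by (intro eq_vecI) (auto simp: C_def)
        then show "(C *\<^sub>v (A ^\<^sub>m n *\<^sub>v x0)) $ i = 0\<^sub>v d $ i"
          using ann i C by simp
      qed (use C in simp)
      have AC: "A + C \<in> carrier_mat d d" using A C by simp
      have "A ^\<^sub>m n *\<^sub>v x0 = (A + C) ^\<^sub>m n *\<^sub>v x0" for n
      proof (induction n)
        case 0
        then show ?case using A C by simp
      next
        case (Suc n)
        have "(A + C) ^\<^sub>m Suc n *\<^sub>v x0 = (A + C) *\<^sub>v (A ^\<^sub>m n *\<^sub>v x0)"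
          using pow_mat_Suc_mult_vec[OF AC x0] Suc by simp
        also have "\<dots> = A *\<^sub>v (A ^\<^sub>m n *\<^sub>v x0) + 0\<^sub>v d"
          using add_mult_distrib_mat_vec[OF A C orbit] C_orbit by simp
        also have "\<dots> = A ^\<^sub>m Suc n *\<^sub>v x0"
          using pow_mat_Suc_mult_vec[OF A x0] orbit[of "Suc n"] by simp
        finally show ?case ..
      qed
      then have "A + C = A" using \<open>?I\<close> AC unfolding ident by blast
      show "v = 0\<^sub>v d"
      proof (rule eq_vecI)
        fix j assume "j < dim_vec (0\<^sub>v d :: real vec)"
        then have j: "j < d" by simp
        have "(A + C) $$ (0, j) = A $$ (0, j)" using \<open>A + C = A\<close> by simp
        then show "v $ j = 0\<^sub>v d $ j" using j A \<open>0 < d\<close> by (simp add: C_def)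
      qed (use v in simp)
    qed
  next
    assume ?S
    show ?I
      unfolding ident
    proof (intro ballI impI)
      fix B assume B: "B \<in> carrier_mat d d" and eq: "\<forall>n. A ^\<^sub>m n *\<^sub>v x0 = B ^\<^sub>m n *\<^sub>v x0"
      have same: "A *\<^sub>v (A ^\<^sub>m n *\<^sub>v x0) = B *\<^sub>v (A ^\<^sub>m n *\<^sub>v x0)" for n
        using pow_mat_Suc_mult_vec[OF A x0, of n] pow_mat_Suc_mult_vec[OF B x0, of n]
          eq[rule_format, of n] eq[rule_format, of "Suc n"] by (simp only:)
      show "B = A"
      proof (rule eq_rowI)
        fix i assume "i < dim_row A"
        then have i: "i < d" using A by simp
        have rows: "row A i \<in> carrier_vec d" "row B i \<in> carrier_vec d" using A B by auto
        have "(row B i - row A i) \<bullet> (A ^\<^sub>m n *\<^sub>v x0) = 0" for n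
        proof -
          have "row B i \<bullet> (A ^\<^sub>m n *\<^sub>v x0) = row A i \<bullet> (A ^\<^sub>m n *\<^sub>v x0)"
            using arg_cong[OF same[of n], of "\<lambda>v. v $ i"] i A B by simp
          then show ?thesis
            using minus_scalar_prod_distrib[OF rows(2,1) orbit] by simp
        qed
        then have "row B i - row A i = 0\<^sub>v d" using \<open>?S\<close> rows by (simp add: cyclic_vector_def)
        then have zero: "(row B i - row A i) $ j = 0" if "j < d" for j
          using that by simp
        show "row B i = row A i"
        proof (rule eq_vecI)
          fix j assume "j < dim_vec (row A i)"
          then show "row B i $ j = row A i $ j" using zero[of j] rows A by simp
        qed (use A B in simp)
      qed (use A B in auto)
    qed
  qed
qed

text \<open>If \<open>u\<close> is orthogonal to the transformed orbit, its image under the transpose of \<open>P'\<close> is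
  orthogonal to the original one, and the transpose of \<open>P'\<close> is injective.\<close>

lemma cyclic_vector_similar:
  assumes cyc: "cyclic_vector d A x" and A: "A \<in> carrier_mat d d" and x: "x \<in> carrier_vec d"
    and sim: "similar_mat_wit A B P P'"
  shows "cyclic_vector d B (P' *\<^sub>v x)"
  unfolding cyclic_vector_def
proof (intro ballI impI)
  note wit = similar_mat_witD2[OF A sim]
  fix u :: "real vec" assume u: "u \<in> carrier_vec d" and ann: "\<forall>n. u \<bullet> (B ^\<^sub>m n *\<^sub>v (P' *\<^sub>v x)) = 0"
  have Pt: "transpose_mat P \<in> carrier_mat d d" and P't: "transpose_mat P' \<in> carrier_mat d d"
    using wit by auto
  define v where "v = transpose_mat P' *\<^sub>v u"
  have v: "v \<in> carrier_vec d" using P't u by (auto simp: v_def)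
  have "v \<bullet> (A ^\<^sub>m n *\<^sub>v x) = 0" for n
  proof -
    have An: "A ^\<^sub>m n \<in> carrier_mat d d" and Bn: "B ^\<^sub>m n \<in> carrier_mat d d" using wit by auto
    have BP': "B ^\<^sub>m n * P' \<in> carrier_mat d d" using Bn wit(7) by simp
    have "P' * A ^\<^sub>m n = P' * (P * (B ^\<^sub>m n * P'))"
      by (simp only: similar_mat_wit_pow_id[OF sim] assoc_mult_mat[OF wit(6) Bn wit(7)])
    also have "\<dots> = P' * P * (B ^\<^sub>m n * P')"
      by (rule assoc_mult_mat[OF wit(7,6) BP', symmetric])
    also have "\<dots> = B ^\<^sub>m n * P'"
      using left_mult_one_mat[OF BP'] by (simp only: wit(2))
    finally have "P' * A ^\<^sub>m n = B ^\<^sub>m n * P'" .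
    then have "P' *\<^sub>v (A ^\<^sub>m n *\<^sub>v x) = B ^\<^sub>m n *\<^sub>v (P' *\<^sub>v x)"
      using assoc_mult_mat_vec[OF wit(7) An x] assoc_mult_mat_vec[OF Bn wit(7) x] by simp
    then show ?thesis
      using transpose_vec_mult_scalar[OF wit(7) mult_mat_vec_carrier[OF An x] u] ann by (simp add: v_def)
  qed
  then have v0: "v = 0\<^sub>v d" using cyc v by (simp add: cyclic_vector_def)
  have "transpose_mat P * transpose_mat P' = 1\<^sub>m d"
    using transpose_mult[OF wit(7,6)] wit(2) by simp
  then have "u = transpose_mat P *\<^sub>v v"
    using assoc_mult_mat_vec[OF Pt P't u] u by (simp add: v_def)
  then show "u = 0\<^sub>v d"
    using Pt v0 by (simp add: mult_mat_vec_def) (auto intro!: eq_vecI)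
qed

lemma cyclic_vector_similar_iff:
  assumes A: "A \<in> carrier_mat d d" and x: "x \<in> carrier_vec d"
    and sim: "similar_mat_wit A B P P'"
  shows "cyclic_vector d A x \<longleftrightarrow> cyclic_vector d B (P' *\<^sub>v x)"
proof
  note wit = similar_mat_witD2[OF A sim]
  have P'x: "P' *\<^sub>v x \<in> carrier_vec d" using wit(7) x by (rule mult_mat_vec_carrier)
  have "P *\<^sub>v (P' *\<^sub>v x) = x"
    using assoc_mult_mat_vec[OF wit(6,7) x] wit(1) x by simp
  moreover assume "cyclic_vector d B (P' *\<^sub>v x)"
  ultimately show "cyclic_vector d A x"
    using cyclic_vector_similar[OF _ wit(5) P'x similar_mat_wit_sym[OF sim]] by simp
qed (rule cyclic_vector_similar[OF _ A x sim])

section \<open>Independence of damped oscillations\<close>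

text \<open>A sequence \<open>Re (m * l ^ n)\<close> satisfies the real linear recurrence with
  characteristic polynomial \<open>q z = (z - l) * (z - cnj l)\<close>. Applying the recurrence operator of
  one frequency \<open>l j\<close> to a vanishing sum removes the term of \<open>j\<close> and multiplies every other
  coefficient by the nonzero number \<open>q (l k)\<close>, which allows induction on the set of
  frequencies. For a real frequency only the real part of the coefficient is visible; hence the
  requirement that these coefficients be real.\<close>

lemma damped_oscillations_independent:
  fixes l m :: "'k \<Rightarrow> complex"
  assumes "finite S"
    and "\<And>j k. j \<in> S \<Longrightarrow> k \<in> S \<Longrightarrow> j \<noteq> k \<Longrightarrow> l k \<noteq> l j \<and> l k \<noteq> cnj (l j)"
    and "\<And>k. k \<in> S \<Longrightarrow> Im (l k) = 0 \<Longrightarrow> Im (m k) = 0"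
    and "\<And>n. (\<Sum>k\<in>S. Re (m k * l k ^ n)) = 0"
    and "k \<in> S"
  shows "m k = 0"
  using assms
proof (induction S arbitrary: m k rule: finite_induct)
  case empty
  then show ?case by simp
next
  case (insert j S)
  define q where "q z = (z - l j) * (z - cnj (l j))" for z
  have q_expand: "q z = z ^ 2 - of_real (2 * Re (l j)) * z + of_real ((cmod (l j))\<^sup>2)" for z
    unfolding q_def complex_norm_square complex_add_cnj[symmetric]
    by (simp add: algebra_simps power2_eq_square)
  \<comment> \<open>As \<open>q\<close> has real coefficients, the recurrence operator commutes with taking real parts.\<close>
  have q_Re: "Re (w * q z * z ^ n) = Re (w * z ^ (n + 2))
      - 2 * Re (l j) * Re (w * z ^ (n + 1)) + (cmod (l j))\<^sup>2 * Re (w * z ^ n)" for w z n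
  proof -
    have "w * q z * z ^ n = w * z ^ (n + 2) - of_real (2 * Re (l j)) * (w * z ^ (n + 1))
        + of_real ((cmod (l j))\<^sup>2) * (w * z ^ n)"
      unfolding q_expand by (simp add: algebra_simps power2_eq_square)
    then show ?thesis
      by (simp only: plus_complex.sel minus_complex.sel Re_complex_of_real Im_complex_of_real times_complex.sel
          mult_zero_left diff_zero)
  qed
  have q_j: "q (l j) = 0" by (simp add: q_def)
  have S_zero: "m k = 0" if k: "k \<in> S" for k
  proof -
    have "m k * q (l k) = 0"
    proof (rule insert.IH[where m = "\<lambda>k. m k * q (l k)"])
      fix n
      have "(\<Sum>k\<in>S. Re (m k * q (l k) * l k ^ n)) = (\<Sum>k\<in>insert j S. Re (m k * q (l k) * l k ^ n))"
        using insert.hyps by (simp add: q_j)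
      also have "\<dots> = (\<Sum>k\<in>insert j S. Re (m k * l k ^ (n + 2)))
          - 2 * Re (l j) * (\<Sum>k\<in>insert j S. Re (m k * l k ^ (n + 1)))
          + (cmod (l j))\<^sup>2 * (\<Sum>k\<in>insert j S. Re (m k * l k ^ n))"
        unfolding q_Re by (simp only: sum.distrib sum_subtractf sum_distrib_left)
      also have "\<dots> = 0" by (simp only: insert.prems(3) mult_zero_right diff_zero add_0)
      finally show "(\<Sum>k\<in>S. Re (m k * q (l k) * l k ^ n)) = 0" .
    next
      fix k assume "k \<in> S" and real: "Im (l k) = 0"
      then have "Im (m k) = 0" using insert.prems(2) by blast
      with real show "Im (m k * q (l k)) = 0"
        unfolding q_expand by (simp add: power2_eq_square)
    qed (use insert.prems(1) k in auto)
    moreover have "q (l k) \<noteq> 0"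
      using insert.prems(1)[of j k] insert.hyps k by (auto simp: q_def)
    ultimately show ?thesis by simp
  qed
  have j_sum: "Re (m j * l j ^ n) = 0" for n
    using insert.prems(3)[of n] insert.hyps S_zero by simp
  \<comment> \<open>The value at \<open>n = 0\<close> gives the real part of the coefficient; at \<open>n = 1\<close> a non-real
    frequency reveals the imaginary part.\<close>
  have "m j = 0"
  proof (rule complex_eqI)
    show "Re (m j) = Re 0" using j_sum[of 0] by simp
    then show "Im (m j) = Im 0"
      using j_sum[of 1] insert.prems(2)[of j] by (cases "Im (l j) = 0") auto
  qed
  with S_zero insert.prems(4) show ?case by blast
qed

section \<open>Complex coordinates of the blocks\<close>

definition block_eigenvalue ::
  "nat \<Rightarrow> (nat \<Rightarrow> real) \<Rightarrow> (nat \<Rightarrow> real) \<Rightarrow> (nat \<Rightarrow> real) \<Rightarrow> nat \<Rightarrow> complex" where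
  "block_eigenvalue K1 c a b k = (if k \<le> K1 then of_real (c k) else Complex (a k) (b k))"

definition block_size :: "nat \<Rightarrow> nat \<Rightarrow> nat" where
  "block_size K1 k = (if k \<le> K1 then 1 else 2)"

text \<open>Counted from 0, whereas \<open>jordan_pos\<close> and the block numbers count from 1.\<close>

definition block_start :: "nat \<Rightarrow> nat \<Rightarrow> nat" where
  "block_start K1 k = (if k \<le> K1 then k - 1 else jordan_pos K1 k - 1)"

text \<open>The two coordinates of a block of size two are read as one complex number, because the
  matrix with rows \<open>(a, - b)\<close> and \<open>(b, a)\<close> is multiplication by \<open>a + b \<i>\<close>.\<close>

definition block_coord :: "nat \<Rightarrow> real vec \<Rightarrow> nat \<Rightarrow> complex" where
  "block_coord K1 y k =
     (if k \<le> K1 then of_real (y $ block_start K1 k)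
      else Complex (y $ block_start K1 k) (y $ (block_start K1 k + 1)))"

lemma block_norm_eq_cmod:
  assumes "1 \<le> k"
  shows "block_norm K1 y k = cmod (block_coord K1 y k)"
proof (cases "k \<le> K1")
  case True
  then show ?thesis by (simp add: block_norm_def block_coord_def block_start_def)
next
  case False
  \<comment> \<open>The truncated subtraction is harmless, since \<open>jordan_pos K1 k\<close> is positive.\<close>
  then have "jordan_pos K1 k - 1 + 1 = jordan_pos K1 k + 1 - 1"
    using assms by (simp add: jordan_pos_def)
  then show ?thesis
    using False by (simp only: block_norm_def block_coord_def block_start_def cmod_def complex.sel if_False)
qed

lemma icis_eq_0_iff:
  assumes "0 < K1 + K2"
  shows "icis K1 K2 Q' x = 0 \<longleftrightarrow> (\<exists>k \<in> {1..K1 + K2}. block_coord K1 (Q' *\<^sub>v x) k = 0)"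
proof -
  let ?N = "block_norm K1 (Q' *\<^sub>v x) ` {1..K1 + K2}"
  have ne: "finite ?N" "?N \<noteq> {}" using assms by auto
  have "Min ?N = 0 \<longleftrightarrow> 0 \<in> ?N"
  proof
    show "0 \<in> ?N" if "Min ?N = 0" using Min_in[OF ne] that by simp
    show "Min ?N = 0" if "0 \<in> ?N"
      using ne that by (intro Min_eqI) (auto simp: block_norm_eq_cmod)
  qed
  also have "\<dots> \<longleftrightarrow> (\<exists>k \<in> {1..K1 + K2}. block_norm K1 (Q' *\<^sub>v x) k = 0)" by (auto simp: image_iff)
  also have "\<dots> \<longleftrightarrow> (\<exists>k \<in> {1..K1 + K2}. block_coord K1 (Q' *\<^sub>v x) k = 0)"
    by (intro bex_cong) (simp_all add: block_norm_eq_cmod)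
  finally show ?thesis by (simp add: icis_def)
qed

lemma sum_over_blocks:
  fixes f :: "nat \<Rightarrow> 'a :: comm_monoid_add"
  shows "(\<Sum>i = 0..<K1 + 2 * K2. f i) =
     (\<Sum>k = 1..K1 + K2. \<Sum>j<block_size K1 k. f (block_start K1 k + j))"
proof (induction K2)
  case 0
  have "(\<Sum>i = 0..<K1. f i) = (\<Sum>k = 1..K1. f (k - 1))"
    by (rule sum.reindex_bij_witness[of _ "\<lambda>k. k - 1" Suc]) auto
  also have "\<dots> = (\<Sum>k = 1..K1. \<Sum>j<block_size K1 k. f (block_start K1 k + j))"
    by (intro sum.cong) (auto simp: block_size_def block_start_def)
  finally show ?case by simp
next
  case (Suc K2)
  have "block_start K1 (Suc (K1 + K2)) = K1 + 2 * K2" "block_size K1 (Suc (K1 + K2)) = 2"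
    by (auto simp: block_start_def jordan_pos_def block_size_def)
  then show ?case
    using Suc by (simp add: numeral_2_eq_2 add.assoc)
qed

text \<open>The Euclidean inner product of the plane is \<open>Re (cnj w * z)\<close>.\<close>

lemma scalar_prod_block_coord:
  assumes "u \<in> carrier_vec (K1 + 2 * K2)" "y \<in> carrier_vec (K1 + 2 * K2)"
  shows "u \<bullet> y = (\<Sum>k = 1..K1 + K2. Re (cnj (block_coord K1 u k) * block_coord K1 y k))"
proof -
  have "u \<bullet> y = (\<Sum>i = 0..<K1 + 2 * K2. u $ i * y $ i)"
    using assms by (simp add: scalar_prod_def)
  also have "\<dots> = (\<Sum>k = 1..K1 + K2. Re (cnj (block_coord K1 u k) * block_coord K1 y k))"
    unfolding sum_over_blocks
    by (intro sum.cong) (auto simp: block_size_def block_coord_def numeral_2_eq_2)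
  finally show ?thesis .
qed

lemma block_containing_index:
  assumes "i < K1 + 2 * K2"
  obtains k j where "1 \<le> k" "k \<le> K1 + K2" "j < block_size K1 k" "i = block_start K1 k + j"
proof (cases "i < K1")
  case True
  then show ?thesis using assms by (intro that[of "Suc i" 0]) (auto simp: block_size_def block_start_def)
next
  case False
  \<comment> \<open>Behind the \<open>K1\<close> real coordinates the blocks come in consecutive pairs.\<close>
  define k where "k = K1 + 1 + (i - K1) div 2"
  have "block_start K1 k = K1 + 2 * ((i - K1) div 2)"
    by (simp add: block_start_def jordan_pos_def k_def)
  moreover have "i - K1 = 2 * ((i - K1) div 2) + (i - K1) mod 2" by simp
  ultimately have "i = block_start K1 k + (i - K1) mod 2" using False by linarith
  moreover have "k \<le> K1 + K2" using assms False unfolding k_def by linarith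
  ultimately show ?thesis
    by (intro that[of k "(i - K1) mod 2"]) (auto simp: k_def block_size_def)
qed

lemma block_index_less:
  assumes "1 \<le> k" "k \<le> K1 + K2" "j < block_size K1 k"
  shows "block_start K1 k + j < K1 + 2 * K2"
  using assms by (auto simp: block_start_def block_size_def jordan_pos_def split: if_splits)

lemma eq_0_iff_block_coord:
  assumes u: "u \<in> carrier_vec (K1 + 2 * K2)"
  shows "u = 0\<^sub>v (K1 + 2 * K2) \<longleftrightarrow> (\<forall>k \<in> {1..K1 + K2}. block_coord K1 u k = 0)"
proof
  assume "u = 0\<^sub>v (K1 + 2 * K2)"
  then show "\<forall>k \<in> {1..K1 + K2}. block_coord K1 u k = 0"
    using block_index_less[of _ K1 K2 0] block_index_less[of _ K1 K2 1]
    by (auto simp: block_coord_def block_size_def complex_eq_iff)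
next
  assume zero: "\<forall>k \<in> {1..K1 + K2}. block_coord K1 u k = 0"
  show "u = 0\<^sub>v (K1 + 2 * K2)"
  proof (rule eq_vecI)
    fix i assume "i < dim_vec (0\<^sub>v (K1 + 2 * K2) :: real vec)"
    then obtain k j where kj: "1 \<le> k" "k \<le> K1 + K2" "j < block_size K1 k" "i = block_start K1 k + j"
      using block_containing_index[of i K1 K2] by auto
    then have "block_coord K1 u k = 0" using zero by simp
    then have "u $ i = 0"
      using kj by (auto simp: block_coord_def block_size_def complex_eq_iff less_2_cases_iff split: if_splits)
    then show "u $ i = 0\<^sub>v (K1 + 2 * K2) $ i" using block_index_less kj by auto
  qed (use u in simp)
qed

section \<open>The action of the real Jordan matrix\<close>

text \<open>The number \<open>sum_list (map dim_row (take k As))\<close> is the offset of block \<open>k\<close>. Peeling off the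
  first block splits the vector as well, so the claim reduces to the remaining blocks.\<close>

lemma diag_block_mat_mult_vec_index:
  fixes v :: "'a :: comm_semiring_1 vec"
  assumes "\<forall>A \<in> set As. square_mat A" and "dim_vec v = sum_list (map dim_row As)"
    and "k < length As" and "i < dim_row (As ! k)"
  shows "(diag_block_mat As *\<^sub>v v) $ (sum_list (map dim_row (take k As)) + i) =
    (\<Sum>j<dim_row (As ! k). (As ! k) $$ (i, j) * v $ (sum_list (map dim_row (take k As)) + j))"
  using assms
proof (induction As arbitrary: v k)
  case Nil
  then show ?case by simp
next
  case (Cons A As)
  define n m where "n = dim_row A" and "m = sum_list (map dim_row As)"
  define D where "D = diag_block_mat As"
  have A: "A \<in> carrier_mat n n" using Cons.prems(1) by (auto simp: n_def)
  have D: "D \<in> carrier_mat m m"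
    using diag_block_mat_square[of As] Cons.prems(1)
    by (auto simp: D_def m_def dim_diag_block_mat square_mat.simps)
  have v: "dim_vec v = n + m" using Cons.prems(2) by (simp add: n_def m_def)
  define x y where "x = vec_first v n" and "y = vec_last v m"
  have v_split: "v = x @\<^sub>v y" unfolding x_def y_def using v by (intro vec_first_last_append[symmetric] carrier_vecI)
  have x: "x \<in> carrier_vec n" and y: "y \<in> carrier_vec m" by (auto simp: x_def y_def)
  have Dy: "D *\<^sub>v y \<in> carrier_vec m" and Ax: "A *\<^sub>v x \<in> carrier_vec n" using A D x y by auto
  have act: "diag_block_mat (A # As) *\<^sub>v v = (A *\<^sub>v x) @\<^sub>v (D *\<^sub>v y)"
    using mult_mat_vec_split[OF A D x y] A D v_split by (simp add: Let_def flip: D_def)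
  show ?case
  proof (cases k)
    case 0
    then have i: "i < n" using Cons.prems(4) by (simp add: n_def)
    have "(A *\<^sub>v x) $ i = (\<Sum>j<n. A $$ (i, j) * x $ j)"
      using A x i by (auto simp: scalar_prod_def lessThan_atLeast0 intro!: sum.cong)
    also have "\<dots> = (\<Sum>j<n. A $$ (i, j) * v $ j)"
      using x y by (intro sum.cong) (auto simp: v_split)
    finally show ?thesis
      unfolding act using i 0 Ax Dy by (simp add: n_def)
  next
    case (Suc k')
    define s where "s = sum_list (map dim_row (take k' As))"
    have k': "k' < length As" "i < dim_row (As ! k')" using Cons.prems Suc by auto
    have "take (Suc k') As @ drop (Suc k') As = As" by simp
    then have "m = sum_list (map dim_row (take (Suc k') As)) + sum_list (map dim_row (drop (Suc k') As))"
      unfolding m_def by (metis map_append sum_list_append)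
    then have s: "s + dim_row (As ! k') \<le> m"
      using k' by (simp add: s_def take_Suc_conv_app_nth)
    have "(diag_block_mat (A # As) *\<^sub>v v) $ (n + (s + i)) = (D *\<^sub>v y) $ (s + i)"
      unfolding act using carrier_vecD[OF Ax] carrier_vecD[OF Dy] s k' by (subst index_append_vec(1)) auto
    also have "\<dots> = (\<Sum>j<dim_row (As ! k'). (As ! k') $$ (i, j) * y $ (s + j))"
      unfolding D_def s_def using Cons.prems y k' by (intro Cons.IH) (auto simp: m_def)
    also have "\<dots> = (\<Sum>j<dim_row (As ! k'). (As ! k') $$ (i, j) * v $ (n + (s + j)))"
      using x y s by (intro sum.cong) (auto simp: v_split)
    finally show ?thesis using Suc by (simp add: s_def n_def add.assoc)
  qed
qed

lemma map_mat_diag_block_mat: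
  assumes "f 0 = 0"
  shows "map_mat f (diag_block_mat As) = diag_block_mat (map (map_mat f) As)"
proof (induction As)
  case Nil
  then show ?case by (intro eq_matI) auto
next
  case (Cons A As)
  have dims: "dim_row (diag_block_mat (map (map_mat f) As)) = dim_row (diag_block_mat As)"
    "dim_col (diag_block_mat (map (map_mat f) As)) = dim_col (diag_block_mat As)"
    by (simp_all flip: Cons)
  show ?case
    using assms by (intro eq_matI) (auto simp: Let_def dims simp flip: Cons)
qed

lemma real_jordan_block_dim [simp]:
  "dim_row (real_jordan_block K1 c a b k) = block_size K1 k"
  "dim_col (real_jordan_block K1 c a b k) = block_size K1 k"
  by (auto simp: real_jordan_block_def block_size_def mat_of_rows_list_def)

lemma sum_list_block_size:
  assumes "1 \<le> k"
  shows "sum_list (map (block_size K1) [1..<k]) = block_start K1 k"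
  using assms
proof (induction k rule: dec_induct)
  case base
  then show ?case by (simp add: block_start_def jordan_pos_def)
next
  case (step k)
  then show ?case by (auto simp: block_start_def jordan_pos_def block_size_def)
qed

lemma real_jordan_matrix_carrier:
  "real_jordan_matrix K1 K2 c a b \<in> carrier_mat (K1 + 2 * K2) (K1 + 2 * K2)"
proof -
  \<comment> \<open>The position just behind the last block is the dimension.\<close>
  have "block_start K1 (K1 + K2 + 1) = K1 + 2 * K2"
    by (simp add: block_start_def jordan_pos_def)
  then have "sum_list (map (block_size K1) [1..<K1 + K2 + 1]) = K1 + 2 * K2"
    using sum_list_block_size[of "K1 + K2 + 1" K1] by simp
  then show ?thesis
    unfolding real_jordan_matrix_def
    by (intro carrier_matI) (simp_all add: dim_diag_block_mat comp_def del: upt_Suc)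
qed

text \<open>Allowing an entrywise map \<open>h\<close> covers both uses at once: the identity for the action on real
  vectors, and the embedding into the complex numbers for eigenvectors.\<close>

lemma real_jordan_matrix_mult_vec_index:
  fixes h :: "real \<Rightarrow> 'a :: comm_semiring_1" and v :: "'a vec"
  assumes h0: "h 0 = 0" and v: "v \<in> carrier_vec (K1 + 2 * K2)"
    and k: "1 \<le> k" "k \<le> K1 + K2" and i: "i < block_size K1 k"
  shows "(map_mat h (real_jordan_matrix K1 K2 c a b) *\<^sub>v v) $ (block_start K1 k + i) =
    (\<Sum>j<block_size K1 k. h (real_jordan_block K1 c a b k $$ (i, j)) * v $ (block_start K1 k + j))"
proof -
  define As where "As = map (\<lambda>k. map_mat h (real_jordan_block K1 c a b k)) [1..<K1 + K2 + 1]"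
  have mat: "map_mat h (real_jordan_matrix K1 K2 c a b) = diag_block_mat As"
    unfolding real_jordan_matrix_def As_def by (simp add: map_mat_diag_block_mat[of h, OF h0] comp_def del: upt_Suc)
  have nth: "As ! (k - 1) = map_mat h (real_jordan_block K1 c a b k)"
    using k nth_upt[of 1 "k - 1" "K1 + K2 + 1"] by (simp add: As_def del: upt_Suc)
  have "sum_list (map dim_row (take (k - 1) As)) = sum_list (map (block_size K1) [1..<k])"
    using k by (simp add: As_def take_map take_upt comp_def del: upt_Suc)
  then have start: "sum_list (map dim_row (take (k - 1) As)) = block_start K1 k"
    using sum_list_block_size k by simp
  have "dim_vec v = sum_list (map dim_row As)"
    using v real_jordan_matrix_carrier[of K1 K2 c a b] arg_cong[OF mat, of dim_row]
    by (simp add: dim_diag_block_mat)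
  moreover have "\<forall>A \<in> set As. square_mat A" by (auto simp: As_def)
  ultimately have "(diag_block_mat As *\<^sub>v v) $ (sum_list (map dim_row (take (k - 1) As)) + i) =
    (\<Sum>j<dim_row (As ! (k - 1)). (As ! (k - 1)) $$ (i, j) * v $ (sum_list (map dim_row (take (k - 1) As)) + j))"
    using k i nth by (intro diag_block_mat_mult_vec_index) (auto simp: As_def simp del: upt_Suc)
  then show ?thesis
    unfolding mat start nth using i by (auto intro!: sum.cong)
qed

lemma real_jordan_block_index:
  "k \<le> K1 \<Longrightarrow> real_jordan_block K1 c a b k $$ (0, 0) = c k"
  "\<not> k \<le> K1 \<Longrightarrow> real_jordan_block K1 c a b k $$ (0, 0) = a k"
  "\<not> k \<le> K1 \<Longrightarrow> real_jordan_block K1 c a b k $$ (0, Suc 0) = - b k"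
  "\<not> k \<le> K1 \<Longrightarrow> real_jordan_block K1 c a b k $$ (Suc 0, 0) = b k"
  "\<not> k \<le> K1 \<Longrightarrow> real_jordan_block K1 c a b k $$ (Suc 0, Suc 0) = a k"
  by (auto simp: real_jordan_block_def mat_of_rows_list_def)

lemma block_coord_real_jordan_matrix:
  assumes y: "y \<in> carrier_vec (K1 + 2 * K2)" and k: "1 \<le> k" "k \<le> K1 + K2"
  shows "block_coord K1 (real_jordan_matrix K1 K2 c a b *\<^sub>v y) k =
    block_eigenvalue K1 c a b k * block_coord K1 y k"
proof -
  have "map_mat (\<lambda>x. x) (real_jordan_matrix K1 K2 c a b) = real_jordan_matrix K1 K2 c a b"
    by (intro eq_matI) auto
  then have ix: "(real_jordan_matrix K1 K2 c a b *\<^sub>v y) $ (block_start K1 k + i) =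
      (\<Sum>j<block_size K1 k. real_jordan_block K1 c a b k $$ (i, j) * y $ (block_start K1 k + j))"
    if "i < block_size K1 k" for i
    using real_jordan_matrix_mult_vec_index[of "\<lambda>x. x", OF _ y k that, of c a b] by simp
  show ?thesis
    using ix[of 0] ix[of 1]
    by (auto simp: block_coord_def block_eigenvalue_def block_size_def numeral_2_eq_2
        real_jordan_block_index complex_eq_iff)
qed

lemma block_coord_real_jordan_matrix_pow:
  assumes y: "y \<in> carrier_vec (K1 + 2 * K2)" and k: "1 \<le> k" "k \<le> K1 + K2"
  shows "block_coord K1 (real_jordan_matrix K1 K2 c a b ^\<^sub>m n *\<^sub>v y) k =
    block_eigenvalue K1 c a b k ^ n * block_coord K1 y k"
  using y
proof (induction n arbitrary: y)
  case 0
  then show ?case using real_jordan_matrix_carrier[of K1 K2 c a b] by simp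
next
  case (Suc n)
  note L = real_jordan_matrix_carrier[of K1 K2 c a b]
  have Ln: "real_jordan_matrix K1 K2 c a b ^\<^sub>m n \<in> carrier_mat (K1 + 2 * K2) (K1 + 2 * K2)"
    using L by simp
  show ?case
    using Suc.IH[OF mult_mat_vec_carrier[OF L Suc.prems]]
      block_coord_real_jordan_matrix[OF Suc.prems k]
    by (simp add: assoc_mult_mat_vec[OF Ln L Suc.prems])
qed

text \<open>A nonzero entry of an eigenvector singles out a block on which the eigenvector does not
  vanish. On a block of size two with entries \<open>p\<close>, \<open>q\<close> the combinations \<open>p + \<i> * q\<close> and
  \<open>p - \<i> * q\<close> are multiplied by \<open>l\<close> and \<open>cnj l\<close>, and they are not both zero; where
  such a combination is nonzero, the eigenvalue must be the factor.\<close>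

lemma eigenvalue_real_jordan_matrix:
  assumes "eigenvalue (map_mat complex_of_real (real_jordan_matrix K1 K2 c a b)) z"
  shows "\<exists>k \<in> {1..K1 + K2}. z = block_eigenvalue K1 c a b k \<or> z = cnj (block_eigenvalue K1 c a b k)"
proof -
  let ?L = "map_mat complex_of_real (real_jordan_matrix K1 K2 c a b)"
  obtain v where v: "v \<in> carrier_vec (K1 + 2 * K2)" "v \<noteq> 0\<^sub>v (K1 + 2 * K2)" and ev: "?L *\<^sub>v v = z \<cdot>\<^sub>v v"
    using assms real_jordan_matrix_carrier[of K1 K2 c a b]
    by (auto simp: eigenvalue_def eigenvector_def)
  have "\<exists>i < K1 + 2 * K2. v $ i \<noteq> 0"
    using v by (auto intro!: eq_vecI)
  then obtain i where i: "i < K1 + 2 * K2" "v $ i \<noteq> 0" by blast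
  then obtain k j where k: "1 \<le> k" "k \<le> K1 + K2" and j: "j < block_size K1 k" "i = block_start K1 k + j"
    using block_containing_index by metis
  have ix: "z * v $ (block_start K1 k + i) = (\<Sum>j<block_size K1 k.
      complex_of_real (real_jordan_block K1 c a b k $$ (i, j)) * v $ (block_start K1 k + j))"
    if "i < block_size K1 k" for i
    using real_jordan_matrix_mult_vec_index[of complex_of_real, OF _ v(1) k that, of c a b]
      block_index_less[OF k that] v(1) by (simp add: ev)
  show ?thesis
  proof (cases "k \<le> K1")
    case True
    then have "z = block_eigenvalue K1 c a b k"
      using ix[of 0] i j by (simp add: block_size_def block_eigenvalue_def real_jordan_block_index)
    then show ?thesis using k by auto
  next
    case False
    define p q where "p = v $ block_start K1 k" and "q = v $ (block_start K1 k + 1)"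
    define l where "l = block_eigenvalue K1 c a b k"
    have l: "l = a k + \<i> * b k" "cnj l = a k - \<i> * b k"
      using False by (auto simp: l_def block_eigenvalue_def complex_eq_iff)
    have zp: "z * p = a k * p - b k * q" and zq: "z * q = b k * p + a k * q"
      using ix[of 0] ix[of 1] False
      by (auto simp: block_size_def real_jordan_block_index numeral_2_eq_2 p_def q_def)
    have "(z - l) * (p + \<i> * q) = z * p + \<i> * (z * q) - l * (p + \<i> * q)"
      by (simp only: algebra_simps)
    also have "\<dots> = 0"
      unfolding zp zq l by (simp add: algebra_simps)
    finally have plus: "z = l \<or> p + \<i> * q = 0" by simp
    have "(z - cnj l) * (p - \<i> * q) = z * p - \<i> * (z * q) - cnj l * (p - \<i> * q)"
      by (simp only: algebra_simps)
    also have "\<dots> = 0"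
      unfolding zp zq l by (simp add: algebra_simps)
    finally have minus: "z = cnj l \<or> p - \<i> * q = 0" by simp
    have "z = l \<or> z = cnj l"
    proof (rule ccontr)
      assume "\<not> ?thesis"
      then have pq: "p + \<i> * q = 0" "p - \<i> * q = 0" using plus minus by blast+
      have "2 * p = (p + \<i> * q) + (p - \<i> * q)" by simp
      then have "p = 0" using pq by simp
      moreover from this have "q = 0" using pq by simp
      moreover have "p \<noteq> 0 \<or> q \<noteq> 0"
        using i j False by (auto simp: p_def q_def block_size_def less_2_cases_iff)
      ultimately show False by blast
    qed
    then show ?thesis using k unfolding l_def by auto
  qed
qed

section \<open>Separation of the eigenvalues\<close>

lemma eigenvalues_similar:
  fixes A B :: "'a :: field mat"
  assumes "A \<in> carrier_mat n n" "B \<in> carrier_mat n n" "similar_mat A B"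
  shows "eigenvalue A z \<longleftrightarrow> eigenvalue B z"
  using assms by (simp add: eigenvalue_root_char_poly char_poly_similar)

lemma similar_mat_complexify:
  assumes A: "A \<in> carrier_mat d d" and sim: "similar_mat_wit A B P P'"
  shows "similar_mat (map_mat complex_of_real A) (map_mat complex_of_real B)"
proof (rule similar_matI)
  note wit = similar_mat_witD2[OF A sim]
  let ?h = "map_mat complex_of_real"
  show "{?h A, ?h B, ?h P, ?h P'} \<subseteq> carrier_mat d d" using wit by auto
  have mult: "?h (X * Y) = ?h X * ?h Y" if "X \<in> carrier_mat d d" "Y \<in> carrier_mat d d" for X Y
    using that by (rule of_real_hom.mat_hom_mult)
  have one: "?h (1\<^sub>m d) = 1\<^sub>m d" by (rule of_real_hom.mat_hom_one)
  show "?h P * ?h P' = 1\<^sub>m d"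
    by (simp only: mult[OF wit(6,7), symmetric] wit(1) one)
  show "?h P' * ?h P = 1\<^sub>m d"
    by (simp only: mult[OF wit(7,6), symmetric] wit(2) one)
  have "P * B \<in> carrier_mat d d" using wit by simp
  then show "?h A = ?h P * ?h B * ?h P'"
    by (simp only: wit(3) mult[OF _ wit(7)] mult[OF wit(6,5)])
qed

text \<open>A counting argument. Block \<open>i\<close> contributes at most \<open>block_size K1 i\<close> eigenvalues, and these
  numbers add up to the dimension. If the eigenvalue of one block were among those of another,
  that block would contribute nothing new and there would be too few eigenvalues.\<close>

lemma block_eigenvalues_separated:
  assumes card: "card {z. eigenvalue (map_mat complex_of_real (real_jordan_matrix K1 K2 c a b)) z} = K1 + 2 * K2"
    and j: "j \<in> {1..K1 + K2}" and k: "k \<in> {1..K1 + K2}" and "j \<noteq> k"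
  shows "block_eigenvalue K1 c a b k \<noteq> block_eigenvalue K1 c a b j"
    and "block_eigenvalue K1 c a b k \<noteq> cnj (block_eigenvalue K1 c a b j)"
proof -
  define l where "l = block_eigenvalue K1 c a b"
  define E where "E i = {l i, cnj (l i)}" for i
  have "l k \<notin> E j"
  proof
    assume "l k \<in> E j"
    then have "E k = E j" by (auto simp: E_def)
    have "card (E i) \<le> block_size K1 i" for i
      by (auto simp: E_def l_def block_eigenvalue_def block_size_def card_insert_if)
    then have "(\<Sum>i\<in>{1..K1 + K2} - {k}. card (E i)) \<le> (\<Sum>i\<in>{1..K1 + K2} - {k}. block_size K1 i)"
      by (rule sum_mono)
    also have "\<dots> < (\<Sum>i\<in>{1..K1 + K2}. block_size K1 i)"
      using k by (intro sum_strict_mono2) (auto simp: block_size_def)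
    also have "\<dots> = K1 + 2 * K2"
      using sum_over_blocks[of "\<lambda>_. 1 :: nat" K1 K2] by simp
    finally have less: "(\<Sum>i\<in>{1..K1 + K2} - {k}. card (E i)) < K1 + 2 * K2" .
    have "{z. eigenvalue (map_mat complex_of_real (real_jordan_matrix K1 K2 c a b)) z}
        \<subseteq> (\<Union>i\<in>{1..K1 + K2}. E i)"
      using eigenvalue_real_jordan_matrix[of K1 K2 c a b] unfolding E_def l_def by blast
    also have "\<dots> = (\<Union>i\<in>{1..K1 + K2} - {k}. E i)"
      using \<open>E k = E j\<close> j \<open>j \<noteq> k\<close> by blast
    finally have "K1 + 2 * K2 \<le> card (\<Union>i\<in>{1..K1 + K2} - {k}. E i)"
      unfolding card[symmetric] by (intro card_mono) (auto simp: E_def)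
    also have "\<dots> \<le> (\<Sum>i\<in>{1..K1 + K2} - {k}. card (E i))"
      by (rule card_UN_le) simp
    finally show False using less by simp
  qed
  then show "block_eigenvalue K1 c a b k \<noteq> block_eigenvalue K1 c a b j"
    and "block_eigenvalue K1 c a b k \<noteq> cnj (block_eigenvalue K1 c a b j)"
    by (auto simp: E_def l_def)
qed

section \<open>Cyclic vectors of a real Jordan matrix\<close>

text \<open>If a block coordinate of \<open>y\<close> is zero, it stays zero along the orbit, so the unit vector at
  the start of the block is orthogonal to the orbit. The converse pairs the orbit with an
  orthogonal vector and compares coefficients of the resulting oscillations; the assumption on
  \<open>b\<close> makes the frequency of a block of size two non-real, so that its coefficient may be an
  arbitrary complex number.\<close>

lemma cyclic_vector_real_jordan_matrix_iff:
  assumes y: "y \<in> carrier_vec (K1 + 2 * K2)"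
    and b: "\<And>k. K1 < k \<Longrightarrow> k \<le> K1 + K2 \<Longrightarrow> b k \<noteq> 0"
    and card: "card {z. eigenvalue (map_mat complex_of_real (real_jordan_matrix K1 K2 c a b)) z} = K1 + 2 * K2"
  shows "cyclic_vector (K1 + 2 * K2) (real_jordan_matrix K1 K2 c a b) y \<longleftrightarrow>
    (\<forall>k \<in> {1..K1 + K2}. block_coord K1 y k \<noteq> 0)"
proof -
  define d L l where "d = K1 + 2 * K2" and "L = real_jordan_matrix K1 K2 c a b"
    and "l = block_eigenvalue K1 c a b"
  have L: "L \<in> carrier_mat d d" using real_jordan_matrix_carrier by (simp add: L_def d_def)
  have Ln: "L ^\<^sub>m n \<in> carrier_mat d d" for n using L by simp
  have yd: "y \<in> carrier_vec d" using y by (simp add: d_def)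
  have orbit: "L ^\<^sub>m n *\<^sub>v y \<in> carrier_vec d" for n
    using Ln yd by (rule mult_mat_vec_carrier)
  have pairing: "u \<bullet> (L ^\<^sub>m n *\<^sub>v y) =
      (\<Sum>k = 1..K1 + K2. Re (cnj (block_coord K1 u k) * block_coord K1 y k * l k ^ n))"
    if u: "u \<in> carrier_vec d" for u n
    unfolding scalar_prod_block_coord[of u K1 K2, OF u[unfolded d_def] orbit[unfolded d_def]]
  proof (rule sum.cong)
    fix k assume "k \<in> {1..K1 + K2}"
    then have "block_coord K1 (L ^\<^sub>m n *\<^sub>v y) k = l k ^ n * block_coord K1 y k"
      using block_coord_real_jordan_matrix_pow[OF y, of k c a b n] by (simp add: L_def l_def)
    then show "Re (cnj (block_coord K1 u k) * block_coord K1 (L ^\<^sub>m n *\<^sub>v y) k) =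
        Re (cnj (block_coord K1 u k) * block_coord K1 y k * l k ^ n)"
      by (simp only: ac_simps)
  qed simp
  have "cyclic_vector d L y" if nz: "\<forall>k \<in> {1..K1 + K2}. block_coord K1 y k \<noteq> 0"
    unfolding cyclic_vector_def
  proof (intro ballI impI)
    fix u :: "real vec" assume u: "u \<in> carrier_vec d" and ann: "\<forall>n. u \<bullet> (L ^\<^sub>m n *\<^sub>v y) = 0"
    have "cnj (block_coord K1 u k) * block_coord K1 y k = 0" if k: "k \<in> {1..K1 + K2}" for k
    proof (rule damped_oscillations_independent[where S = "{1..K1 + K2}" and l = l
          and m = "\<lambda>k. cnj (block_coord K1 u k) * block_coord K1 y k"])
      fix i j assume "i \<in> {1..K1 + K2}" "j \<in> {1..K1 + K2}" "i \<noteq> j"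
      then show "l j \<noteq> l i \<and> l j \<noteq> cnj (l i)"
        using block_eigenvalues_separated[OF card] by (simp add: l_def)
    next
      fix i assume "i \<in> {1..K1 + K2}" "Im (l i) = 0"
      then have "i \<le> K1" using b[of i] by (auto simp: l_def block_eigenvalue_def split: if_splits)
      then show "Im (cnj (block_coord K1 u i) * block_coord K1 y i) = 0"
        by (simp add: block_coord_def)
    next
      fix n
      show "(\<Sum>k = 1..K1 + K2. Re (cnj (block_coord K1 u k) * block_coord K1 y k * l k ^ n)) = 0"
        using pairing[OF u] ann by simp
    qed (use k in simp_all)
    then have "\<forall>k \<in> {1..K1 + K2}. block_coord K1 u k = 0" using nz by simp
    then show "u = 0\<^sub>v d" using eq_0_iff_block_coord[of u K1 K2] u by (simp add: d_def)
  qed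
  moreover have "block_coord K1 y k \<noteq> 0" if cyc: "cyclic_vector d L y" and k: "k \<in> {1..K1 + K2}" for k
  proof
    assume zero: "block_coord K1 y k = 0"
    have s: "block_start K1 k < d"
      using block_index_less[of k K1 K2 0] k by (simp add: d_def block_size_def split: if_splits)
    have "unit_vec d (block_start K1 k) \<bullet> (L ^\<^sub>m n *\<^sub>v y) = 0" for n
    proof -
      have "block_coord K1 (L ^\<^sub>m n *\<^sub>v y) k = 0"
        using block_coord_real_jordan_matrix_pow[OF y, of k c a b n] k zero by (simp add: L_def)
      then have "(L ^\<^sub>m n *\<^sub>v y) $ block_start K1 k = 0"
        by (simp add: block_coord_def complex_eq_iff split: if_splits)
      then show ?thesis using s orbit by simp
    qed
    then have "unit_vec d (block_start K1 k) = (0\<^sub>v d :: real vec)"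
      using cyc by (simp add: cyclic_vector_def)
    then show False using s by simp
  qed
  ultimately show ?thesis unfolding d_def L_def by blast
qed

theorem theorem2p4:
  fixes d K1 K2 :: nat and T :: real and A Q Q' :: "real mat" and x0 :: "real vec"
    and c a b :: "nat \<Rightarrow> real"
  assumes "0 < d" and "0 < T"
    and "A \<in> carrier_mat d d"
    and "card {l. eigenvalue (map_mat complex_of_real A) l} = d"
    and "x0 \<in> carrier_vec d"
    and "real_jordan_decomposition A Q Q' K1 K2 c a b"
  shows "identifiable_at d T A x0 \<longleftrightarrow> icis K1 K2 Q' x0 \<noteq> 0"
proof -
  note A = assms(3) and x0 = assms(5)
  define L where "L = real_jordan_matrix K1 K2 c a b"
  have d: "d = K1 + 2 * K2" and b: "\<And>k. K1 < k \<Longrightarrow> k \<le> K1 + K2 \<Longrightarrow> b k \<noteq> 0"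
    and sim: "similar_mat_wit A L Q Q'"
    using assms(6) A by (auto simp: real_jordan_decomposition_def L_def)
  note wit = similar_mat_witD2[OF A sim]
  have "Q' *\<^sub>v x0 \<in> carrier_vec d" using wit(7) x0 by (rule mult_mat_vec_carrier)
  moreover have "eigenvalue (map_mat complex_of_real A) = eigenvalue (map_mat complex_of_real L)"
    using eigenvalues_similar[OF _ _ similar_mat_complexify[OF A sim], of d] A wit(5) by auto
  ultimately have "cyclic_vector d L (Q' *\<^sub>v x0) \<longleftrightarrow>
      (\<forall>k \<in> {1..K1 + K2}. block_coord K1 (Q' *\<^sub>v x0) k \<noteq> 0)"
    using assms(4) b unfolding d L_def by (intro cyclic_vector_real_jordan_matrix_iff) auto
  then show ?thesis
    using identifiable_at_iff_cyclic_vector[OF assms(1,2) A x0]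
      cyclic_vector_similar_iff[OF A x0 sim] icis_eq_0_iff[of K1 K2 Q' x0] \<open>0 < d\<close> d
    by auto
qed

end
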